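(* For every $\varepsilon>0$ there exists $\ell_0$ such that for every $\ell\ge\ell_0$ divisible by four, \[c(\ell)\le1+\left(\frac{2}{\pi}+\varepsilon\right)^{\ell}.\]
   Context: For $n\ge\ell\ge3$, $C(n,\ell)$ is the maximum number of directed cycles of length $\ell$ in an $n$-vertex tournament, $R(n,\ell)=\frac{(\ell-1)!}{2^\ell}\binom n\ell$ is the expected number of such cycles in the uniformly random $n$-vertex tournament, and $c(\ell)=\lim_{n\to\infty}C(n,\ell)/R(n,\ell)$. *)

theory Defs
  imports Complex_Main
begin

definition tournament :: "'a set \<Rightarrow> ('a \<times> 'a) set \<Rightarrow> bool" where
  "tournament V E \<longleftrightarrow> E \<subseteq> V \<times> V \<and> asym E \<and> total_on V E"

definition cycle_arcs :: "'a list \<Rightarrow> ('a \<times> 'a) set" where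
  "cycle_arcs xs = {(xs ! i, xs ! (Suc i mod length xs)) | i. i < length xs}"

text \<open>A directed cycle is identified with its set of arcs, so the \<open>l\<close> rotations of a vertex
  sequence of length \<open>l\<close> give one and the same cycle.\<close>

definition directed_cycles :: "nat \<Rightarrow> ('a \<times> 'a) set \<Rightarrow> ('a \<times> 'a) set set" where
  "directed_cycles l E = {cycle_arcs xs | xs. distinct xs \<and> length xs = l \<and> cycle_arcs xs \<subseteq> E}"

text \<open>\<open>C(n, l)\<close>. Every \<open>n\<close>-vertex tournament is isomorphic to one on the vertex set \<open>{..<n}\<close>.\<close>

definition max_cycles :: "nat \<Rightarrow> nat \<Rightarrow> nat" where
  "max_cycles n l = Max ((\<lambda>E. card (directed_cycles l E)) ` {E. tournament {..<n} E})"

text \<open>The maximum in \<open>max_cycles\<close> is over a finite nonempty set, and \<open>card\<close> is applied to finite sets.\<close>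

lemma finite_tournaments: "finite V \<Longrightarrow> finite {E. tournament V E}"
  by (rule finite_subset[of _ "Pow (V \<times> V)"]) (auto simp: tournament_def)

lemma tournament_exists: "\<exists>E. tournament {..<n::nat} E"
  by (rule exI[of _ "{(u, v). u < v \<and> v < n}"])
     (auto simp: tournament_def total_on_def intro!: asymI)

lemma finite_directed_cycles: "finite E \<Longrightarrow> finite (directed_cycles l E)"
  by (rule finite_subset[of _ "Pow E"]) (auto simp: directed_cycles_def)

text \<open>\<open>R(n, l)\<close>, the expected number of cycles of length \<open>l\<close> in the uniformly random
  \<open>n\<close>-vertex tournament.\<close>

definition random_cycles :: "nat \<Rightarrow> nat \<Rightarrow> real" where
  "random_cycles n l = fact (l - 1) / 2 ^ l * real (n choose l)"

text \<open>\<open>c(l)\<close>. The limit exists for \<open>l \<ge> 3\<close>, as \<open>C(n, l) / (n choose l)\<close> is nonincreasing in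
  \<open>n \<ge> l\<close> by averaging over vertex deletions.\<close>

definition cycle_density :: "nat \<Rightarrow> real" where
  "cycle_density l = lim (\<lambda>n. real (max_cycles n l) / random_cycles n l)"

end

theory Submission
  imports
    Defs
    "HOL-Analysis.Gamma_Function"
    "HOL-Analysis.Generalised_Binomial_Theorem"
    "Jordan_Normal_Form.Schur_Decomposition"
begin

text \<open>
  Let \<open>A\<close> be the adjacency matrix of an \<open>n\<close>-vertex tournament and \<open>M = A + I / 2\<close>, so that
  \<open>M + M\<^sup>T\<close> is the all-ones matrix. Then \<open>l\<close> times the number of \<open>l\<close>-cycles is at most the trace
  of \<open>M\<^sup>l\<close>, the sum of the \<open>l\<close>-th powers of the eigenvalues of \<open>M\<close>. The quadratic form of \<open>M\<close> shows
  that the eigenvalues have nonnegative real parts, and these sum to \<open>n / 2\<close>; as the trace of \<open>M\<^sup>2\<close>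
  is nonnegative, the squared moduli sum to at most \<open>n\<^sup>2 / 2\<close>.

  The imaginary parts are at most \<open>n / pi\<close> in absolute value. This follows from the isoperimetric
  inequality for zonogons \<open>\<Sum>\<^sub>i\<^sub>,\<^sub>j \<bar>v\<^sub>i \<times> v\<^sub>j\<bar> \<le> (2 / pi) (\<Sum>\<^sub>i \<bar>v\<^sub>i\<bar>)\<^sup>2\<close>, that is, from the positive definiteness
  of \<open>2 / pi - \<bar>sin t\<bar>\<close> on the circle, which is read off the binomial series of
  \<open>\<bar>sin t\<bar> = sqrt (1 - cos\<^sup>2 t)\<close>; the constant comes from the Wallis product.

  If some eigenvalue has real part close to \<open>n / 2\<close>, it contributes at most \<open>(n / 2)\<^sup>l\<close>, and all others
  have small real part, hence modulus at most \<open>(1 / pi + \<delta>) n\<close>. Otherwise all moduli are at most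
  \<open>(1 / 2 - \<delta>) n\<close> and the whole power sum is below \<open>(n / 2)\<^sup>l\<close> for large \<open>l\<close>.
\<close>

subsection \<open>The mean of the absolute cross products of plane vectors\<close>

text \<open>This is the mean of \<open>cos t ^ (2 * k)\<close> over the circle and also, up to the
  factor \<open>- 1 / (2 * k - 1)\<close>, the coefficient of \<open>y ^ k\<close> in
  \<open>sqrt (1 - y)\<close>. Both roles meet in \<open>sum_cbin_square_telescope\<close>.\<close>

definition cbin :: "nat \<Rightarrow> real" where
  "cbin k = real (2 * k choose k) / 4 ^ k"

lemma cbin_0 [simp]: "cbin 0 = 1"
  by (simp add: cbin_def)

lemma cbin_nonneg [simp]: "0 \<le> cbin k"
  by (simp add: cbin_def)

lemma cbin_Suc: "cbin (Suc k) = cbin k * (2 * real k + 1) / (2 * real k + 2)"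
proof -
  have fact: "cbin m = fact (2 * m) / (fact m * fact m * 4 ^ m)" for m
    unfolding cbin_def by (subst binomial_fact) (auto simp: mult_2)
  have "fact (2 * Suc k) = (2 * real k + 2) * (2 * real k + 1) * fact (2 * k)"
    by (simp add: algebra_simps)
  then show ?thesis
    unfolding fact by (simp add: divide_simps) (simp add: algebra_simps)
qed

text \<open>These are the coefficients of \<open>sqrt (1 - y)\<close>: 1 for \<open>k = 0\<close>
  and negative afterwards, so truncating the series bounds the root from above.\<close>

lemma gbinomial_half_cbin: "(1 / 2 gchoose k) * (- 1) ^ k = - cbin k / (2 * real k - 1)"
proof (induction k)
  case (Suc k)
  have "(1 / 2 gchoose Suc k) = (1 / 2 gchoose k) * (1 / 2 - real k) / (real k + 1)"
    using gbinomial_mult_1[of "1 / 2 :: real" k] by (simp add: field_simps)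
  then have "(1 / 2 gchoose Suc k) * (- 1) ^ Suc k
      = (1 / 2 gchoose k) * (1 / 2 - real k) / (real k + 1) * (- 1) ^ Suc k"
    by (rule arg_cong)
  also have "\<dots> = ((1 / 2 gchoose k) * (- 1) ^ k) * (real k - 1 / 2) / (real k + 1)"
    by (simp add: field_simps)
  also have "\<dots> = - cbin k / (2 * real k - 1) * (real k - 1 / 2) / (real k + 1)"
    by (simp only: Suc.IH)
  also have "\<dots> = - cbin k / (2 * (real k + 1))"
  proof -
    \<comment> \<open>By parity the denominator cannot vanish.\<close>
    have "2 * real k \<noteq> 1" by (metis of_nat_1 of_nat_eq_iff of_nat_mult of_nat_numeral odd_one dvd_triv_left)
    then show ?thesis by (simp add: divide_simps) (simp add: algebra_simps)
  qed
  also have "\<dots> = - cbin (Suc k) / (2 * real (Suc k) - 1)"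
    by (simp add: cbin_Suc divide_simps)
  finally show ?case .
qed simp

text \<open>This is the truncated series at \<open>y = 1\<close>, an endpoint not covered by the
  binomial theorem on the open interval; there the root is 0 and nonnegativity of
  \<open>cbin N\<close> suffices.\<close>

lemma sum_cbin_telescope: "1 - (\<Sum>k=1..N. cbin k / (2 * real k - 1)) = cbin N"
proof (induction N)
  case (Suc N)
  then have "1 - (\<Sum>k=1..Suc N. cbin k / (2 * real k - 1)) = cbin N - cbin (Suc N) / (2 * real (Suc N) - 1)"
    by simp
  also have "\<dots> = cbin (Suc N)"
    by (simp add: cbin_Suc divide_simps) (simp add: algebra_simps)
  finally show ?case .
qed simp

text \<open>The left side arises from the truncated series for \<open>\<bar>sin t\<bar>\<close> by
  replacing each \<open>cos t ^ (2 * k)\<close> with its mean \<open>cbin k\<close>, so its limit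
  should be \<open>2 / pi\<close>, the mean of \<open>\<bar>sin t\<bar>\<close>.\<close>

lemma sum_cbin_square_telescope:
  "1 - (\<Sum>k=1..N. cbin k / (2 * real k - 1) * cbin k) = (2 * real N + 1) * (cbin N)\<^sup>2"
proof (induction N)
  case (Suc N)
  then have "1 - (\<Sum>k=1..Suc N. cbin k / (2 * real k - 1) * cbin k)
      = (2 * real N + 1) * (cbin N)\<^sup>2 - (cbin (Suc N))\<^sup>2 / (2 * real (Suc N) - 1)"
    by (simp add: power2_eq_square)
  also have "\<dots> = (2 * real (Suc N) + 1) * (cbin (Suc N))\<^sup>2"
    by (simp add: cbin_Suc power2_eq_square divide_simps) (simp add: algebra_simps)
  finally show ?case .
qed simp

text \<open>The sequence consists of the reciprocals of the partial Wallis products, which tend to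
  \<open>pi / 2\<close>.\<close>

lemma cbin_wallis: "(\<lambda>N. (2 * real N + 1) * (cbin N)\<^sup>2) \<longlonglongrightarrow> 2 / pi"
proof -
  have eq: "inverse (\<Prod>k=1..N. (4 * real k ^ 2) / (4 * real k ^ 2 - 1)) = (2 * real N + 1) * (cbin N)\<^sup>2" for N
  proof (induction N)
    case (Suc N)
    have "inverse (\<Prod>k=1..Suc N. (4 * real k ^ 2) / (4 * real k ^ 2 - 1))
       = (2 * real N + 1) * (cbin N)\<^sup>2 * ((4 * (real N + 1) ^ 2 - 1) / (4 * (real N + 1) ^ 2))"
      unfolding Suc.IH[symmetric] by (simp add: add.commute field_simps)
    also have "\<dots> = (2 * real (Suc N) + 1) * (cbin (Suc N))\<^sup>2"
      by (simp add: cbin_Suc power2_eq_square divide_simps) (simp add: algebra_simps)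
    finally show ?case .
  qed simp
  have "(\<lambda>N. inverse (\<Prod>k=1..N. (4 * real k ^ 2) / (4 * real k ^ 2 - 1))) \<longlonglongrightarrow> inverse (pi / 2)"
    by (intro tendsto_inverse wallis) simp
  then show ?thesis unfolding eq by simp
qed

text \<open>Applied to \<open>y = cos\<^sup>2 t\<close>, this truncated binomial series bounds \<open>\<bar>sin t\<bar>\<close> by one minus a
  nonnegative combination of the positive definite functions \<open>cos\<^sup>2\<^sup>k t\<close>.\<close>

lemma sqrt_one_minus_le:
  assumes "0 \<le> y" "y \<le> 1"
  shows "sqrt (1 - y) \<le> 1 - (\<Sum>k=1..N. cbin k / (2 * real k - 1) * y ^ k)"
proof (cases "y = 1")
  case True
  then show ?thesis using sum_cbin_telescope[of N] by simp
next
  case False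
  with assms have "y < 1" by simp
  have "(\<lambda>k. (1 / 2 gchoose k) * (- y) ^ k) sums sqrt (1 + - y)"
    using gen_binomial_real[of "- y" "1 / 2"] \<open>y < 1\<close> assms by (simp add: powr_half_sqrt)
  moreover have "(1 / 2 gchoose k) * (- y) ^ k = - (cbin k / (2 * real k - 1) * y ^ k)" for k
  proof -
    have "(1 / 2 gchoose k) * (- y) ^ k = ((1 / 2 gchoose k) * (- 1) ^ k) * y ^ k"
      by (simp add: power_minus[of y])
    then show ?thesis unfolding gbinomial_half_cbin by simp
  qed
  ultimately have sums: "(\<lambda>k. cbin k / (2 * real k - 1) * y ^ k) sums (- sqrt (1 - y))"
    using sums_minus by fastforce
  \<comment> \<open>The only negative term is the one for \<open>k = 0\<close>, equal to -1; the
    terms dropped beyond \<open>N\<close> are nonnegative.\<close>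
  have "(\<Sum>k\<in>{..N}. cbin k / (2 * real k - 1) * y ^ k) \<le> - sqrt (1 - y)"
  proof (rule sum_le_suminf[of _ "{..N}", OF sums_summable[OF sums], unfolded sums_unique[OF sums, symmetric]])
    fix k assume "k \<in> - {..N}"
    then have "0 < real k" by auto
    then have "k \<ge> 1" by simp
    then show "0 \<le> cbin k / (2 * real k - 1) * y ^ k" using assms by simp
  qed simp
  also have "(\<Sum>k\<in>{..N}. cbin k / (2 * real k - 1) * y ^ k)
     = -1 + (\<Sum>k=1..N. cbin k / (2 * real k - 1) * y ^ k)"
    by (simp add: atMost_atLeast0 sum.atLeast_Suc_atMost)
  finally show ?thesis by simp
qed

section \<open>Positive definiteness of even powers of the cosine\<close>

lemma Re_power_even:
  fixes z :: complex
  shows "complex_of_real (Re z ^ (2 * k))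
    = (\<Sum>m\<le>2 * k. of_real (real (2 * k choose m) / 4 ^ k) * (z ^ m * cnj z ^ (2 * k - m)))"
proof -
  have "complex_of_real (Re z) = (z + cnj z) / 2"
    by (simp add: complex_add_cnj)
  then have "complex_of_real (Re z ^ (2 * k)) = ((z + cnj z) / 2) ^ (2 * k)"
    by (simp only: of_real_power)
  also have "\<dots> = (z + cnj z) ^ (2 * k) / 4 ^ k"
    by (simp add: power_divide power_mult)
  also have "(z + cnj z) ^ (2 * k) = (\<Sum>m\<le>2 * k. of_nat (2 * k choose m) * z ^ m * cnj z ^ (2 * k - m))"
    by (rule binomial_ring)
  finally show ?thesis
    by (simp add: sum_divide_distrib mult_ac)
qed

text \<open>For \<open>z = cnj (u i) * u j\<close>, each term in the binomial expansion of
  \<open>Re z ^ (2 * k)\<close> is a conjugated factor in \<open>i\<close> times the same factor in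
  \<open>j\<close>. The double sum is thus a nonnegative combination of squared moduli, of which
  only the constant mode \<open>m = k\<close>, with weight \<open>cbin k\<close>, is kept.\<close>

lemma sum_Re_power_even_ge:
  fixes u :: "'a \<Rightarrow> complex" and r :: "'a \<Rightarrow> real"
  assumes u: "\<And>i. i \<in> S \<Longrightarrow> cmod (u i) = 1"
  shows "cbin k * (\<Sum>i\<in>S. r i)\<^sup>2 \<le> (\<Sum>i\<in>S. \<Sum>j\<in>S. r i * r j * Re (cnj (u i) * u j) ^ (2 * k))"
proof -
  define w where "w m i = of_real (r i) * (u i ^ m * cnj (u i) ^ (2 * k - m))" for m i
  define c where "c m = real (2 * k choose m) / 4 ^ k" for m
  have "complex_of_real (\<Sum>i\<in>S. \<Sum>j\<in>S. r i * r j * Re (cnj (u i) * u j) ^ (2 * k))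
     = (\<Sum>i\<in>S. \<Sum>j\<in>S. \<Sum>m\<le>2 * k. of_real (c m) * (cnj (w m i) * w m j))"
    unfolding of_real_sum of_real_mult Re_power_even
    by (intro sum.cong refl) (simp add: sum_distrib_left w_def c_def power_mult_distrib mult_ac)
  also have "\<dots> = (\<Sum>i\<in>S. \<Sum>m\<le>2 * k. \<Sum>j\<in>S. of_real (c m) * (cnj (w m i) * w m j))"
    by (intro sum.cong refl sum.swap)
  also have "\<dots> = (\<Sum>m\<le>2 * k. \<Sum>i\<in>S. \<Sum>j\<in>S. of_real (c m) * (cnj (w m i) * w m j))"
    by (rule sum.swap)
  also have "\<dots> = (\<Sum>m\<le>2 * k. of_real (c m) * (cnj (\<Sum>i\<in>S. w m i) * (\<Sum>j\<in>S. w m j)))"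
    unfolding cnj_sum sum_product by (simp add: sum_distrib_left)
  also have "\<dots> = complex_of_real (\<Sum>m\<le>2 * k. c m * (cmod (\<Sum>i\<in>S. w m i))\<^sup>2)"
    unfolding of_real_sum of_real_mult complex_norm_square
    by (simp only: mult.commute[of "cnj (sum _ _)"])
  finally have eq: "(\<Sum>i\<in>S. \<Sum>j\<in>S. r i * r j * Re (cnj (u i) * u j) ^ (2 * k))
      = (\<Sum>m\<le>2 * k. c m * (cmod (\<Sum>i\<in>S. w m i))\<^sup>2)"
    using of_real_eq_iff by blast
  have "w k i = of_real (r i)" if "i \<in> S" for i
  proof -
    have "u i * cnj (u i) = 1" using u[OF that] complex_norm_square[of "u i"] by simp
    then show ?thesis by (simp add: w_def power_mult_distrib[symmetric] mult_2)
  qed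
  then have "cmod (\<Sum>i\<in>S. w k i) = \<bar>\<Sum>i\<in>S. r i\<bar>"
    by (simp add: of_real_sum[symmetric] del: of_real_sum)
  then have "cbin k * (\<Sum>i\<in>S. r i)\<^sup>2 = c k * (cmod (\<Sum>i\<in>S. w k i))\<^sup>2"
    by (simp add: cbin_def c_def)
  also have "\<dots> \<le> (\<Sum>m\<le>2 * k. c m * (cmod (\<Sum>i\<in>S. w m i))\<^sup>2)"
    by (rule member_le_sum) (auto simp: c_def)
  finally show ?thesis unfolding eq .
qed

text \<open>\<open>Im (cnj a * b)\<close> is the cross product of plane vectors. The even cosine
  powers enter the bound on \<open>\<bar>sin t\<bar>\<close> with negative sign, so
  \<open>sum_Re_power_even_ge\<close> gives an upper bound for every truncation \<open>N\<close>;
  then \<open>N\<close> tends to infinity.\<close>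

lemma sum_abs_Im_le:
  fixes v :: "'a \<Rightarrow> complex"
  shows "(\<Sum>i\<in>S. \<Sum>j\<in>S. \<bar>Im (cnj (v i) * v j)\<bar>) \<le> 2 / pi * (\<Sum>i\<in>S. cmod (v i))\<^sup>2"
proof -
  \<comment> \<open>A zero vector gets direction 1, so that every \<open>u i\<close> lies on the
    unit circle.\<close>
  define u where "u i = (if v i = 0 then 1 else sgn (v i))" for i
  define r where "r i = cmod (v i)" for i
  define a where "a k = cbin k / (2 * real k - 1)" for k
  have v: "v i = of_real (r i) * u i" and u: "cmod (u i) = 1" for i
    by (auto simp: u_def r_def norm_sgn) (simp add: sgn_eq)
  have bound: "(\<Sum>i\<in>S. \<Sum>j\<in>S. \<bar>Im (cnj (v i) * v j)\<bar>) \<le> (2 * real N + 1) * (cbin N)\<^sup>2 * (\<Sum>i\<in>S. r i)\<^sup>2" for N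
  proof -
    have "\<bar>Im (cnj (v i) * v j)\<bar> \<le> r i * r j - (\<Sum>k=1..N. a k * (r i * r j * Re (cnj (u i) * u j) ^ (2 * k)))" for i j
    proof -
      define z where "z = cnj (u i) * u j"
      have "cmod z = 1" by (simp add: z_def norm_mult u)
      then have z: "(Re z)\<^sup>2 + (Im z)\<^sup>2 = 1" by (simp add: cmod_def)
      then have "(Re z)\<^sup>2 \<le> 1" using zero_le_power2[of "Im z"] by linarith
      have "\<bar>Im z\<bar> = sqrt (1 - (Re z)\<^sup>2)" using z by (metis add_diff_cancel_left' real_sqrt_abs)
      also have "\<dots> \<le> 1 - (\<Sum>k=1..N. a k * ((Re z)\<^sup>2) ^ k)"
        unfolding a_def by (rule sqrt_one_minus_le) (use \<open>(Re z)\<^sup>2 \<le> 1\<close> in auto)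
      finally have "r i * r j * \<bar>Im z\<bar> \<le> r i * r j * (1 - (\<Sum>k=1..N. a k * ((Re z)\<^sup>2) ^ k))"
        by (intro mult_left_mono) (auto simp: r_def)
      moreover have "\<bar>Im (cnj (v i) * v j)\<bar> = r i * r j * \<bar>Im z\<bar>"
      proof -
        have vz: "cnj (v i) * v j = of_real (r i * r j) * z" by (simp add: v z_def)
        have "Im (cnj (v i) * v j) = r i * r j * Im z"
          unfolding vz by simp
        then show ?thesis by (simp add: abs_mult r_def)
      qed
      ultimately show ?thesis
        unfolding z_def[symmetric] power_mult by (simp add: right_diff_distrib sum_distrib_left mult_ac)
    qed
    then have "(\<Sum>i\<in>S. \<Sum>j\<in>S. \<bar>Im (cnj (v i) * v j)\<bar>)
       \<le> (\<Sum>i\<in>S. \<Sum>j\<in>S. r i * r j - (\<Sum>k=1..N. a k * (r i * r j * Re (cnj (u i) * u j) ^ (2 * k))))"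
      by (intro sum_mono)
    also have "\<dots> = (\<Sum>i\<in>S. r i)\<^sup>2 - (\<Sum>i\<in>S. \<Sum>j\<in>S. \<Sum>k=1..N. a k * (r i * r j * Re (cnj (u i) * u j) ^ (2 * k)))"
      by (simp add: sum_subtractf sum_product power2_eq_square)
    also have "(\<Sum>i\<in>S. \<Sum>j\<in>S. \<Sum>k=1..N. a k * (r i * r j * Re (cnj (u i) * u j) ^ (2 * k)))
        = (\<Sum>i\<in>S. \<Sum>k=1..N. \<Sum>j\<in>S. a k * (r i * r j * Re (cnj (u i) * u j) ^ (2 * k)))"
      by (intro sum.cong refl sum.swap)
    also have "\<dots> = (\<Sum>k=1..N. \<Sum>i\<in>S. \<Sum>j\<in>S. a k * (r i * r j * Re (cnj (u i) * u j) ^ (2 * k)))"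
      by (rule sum.swap)
    also have "\<dots> = (\<Sum>k=1..N. a k * (\<Sum>i\<in>S. \<Sum>j\<in>S. r i * r j * Re (cnj (u i) * u j) ^ (2 * k)))"
      by (simp only: sum_distrib_left)
    also have "(\<Sum>i\<in>S. r i)\<^sup>2 - \<dots> \<le> (\<Sum>i\<in>S. r i)\<^sup>2 - (\<Sum>k=1..N. a k * (cbin k * (\<Sum>i\<in>S. r i)\<^sup>2))"
      by (intro diff_left_mono sum_mono mult_left_mono sum_Re_power_even_ge u) (auto simp: a_def)
    also have "\<dots> = (1 - (\<Sum>k=1..N. a k * cbin k)) * (\<Sum>i\<in>S. r i)\<^sup>2"
      by (simp add: left_diff_distrib sum_distrib_right mult.assoc)
    also have "\<dots> = (2 * real N + 1) * (cbin N)\<^sup>2 * (\<Sum>i\<in>S. r i)\<^sup>2"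
      unfolding a_def sum_cbin_square_telescope ..
    finally show ?thesis .
  qed
  have "(\<lambda>N. (2 * real N + 1) * (cbin N)\<^sup>2 * (\<Sum>i\<in>S. r i)\<^sup>2) \<longlonglongrightarrow> 2 / pi * (\<Sum>i\<in>S. r i)\<^sup>2"
    by (intro tendsto_mult_right cbin_wallis)
  from LIMSEQ_le_const[OF this] bound show ?thesis unfolding r_def by blast
qed

subsection \<open>Cycles and closed walks\<close>

text \<open>Letting the index run over all naturals modulo the length turns rotation into a shift of
  the index.\<close>

lemma cycle_arcs_eq_range:
  assumes "xs \<noteq> []"
  shows "cycle_arcs xs = range (\<lambda>i. (xs ! (i mod length xs), xs ! (Suc i mod length xs)))"
proof -
  have "(xs ! (i mod length xs), xs ! (Suc i mod length xs)) \<in> cycle_arcs xs" for i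
    unfolding cycle_arcs_def using assms
    by (auto intro!: exI[of _ "i mod length xs"] simp: mod_Suc_eq)
  moreover have "cycle_arcs xs \<subseteq> range (\<lambda>i. (xs ! (i mod length xs), xs ! (Suc i mod length xs)))"
    unfolding cycle_arcs_def by (auto simp: image_iff) (metis mod_less)
  ultimately show ?thesis by blast
qed

lemma fst_cycle_arcs: "fst ` cycle_arcs xs = set xs"
  by (force simp: cycle_arcs_def set_conv_nth image_iff)

lemma cycle_arcs_eq_image:
  "cycle_arcs xs = (\<lambda>i. (xs ! i, xs ! (Suc i mod length xs))) ` {..<length xs}"
  by (auto simp: cycle_arcs_def)

lemma cycle_arcs_map: "cycle_arcs (map f xs) = map_prod f f ` cycle_arcs xs"
  unfolding cycle_arcs_eq_image image_image
  by (rule image_cong) (auto intro!: nth_map mod_less_divisor)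

lemma cycle_arcs_rotate: "cycle_arcs (rotate m xs) = cycle_arcs xs"
proof (cases "xs = []")
  case False
  have sub: "cycle_arcs (rotate m ys) \<subseteq> cycle_arcs ys" if "ys \<noteq> []" for m and ys :: "'a list"
  proof -
    have "rotate m ys ! (i mod length ys) = ys ! ((m + i) mod length ys)" for i
      using that by (simp add: nth_rotate mod_simps)
    then have "cycle_arcs (rotate m ys)
        = (\<lambda>i. (ys ! (i mod length ys), ys ! (Suc i mod length ys))) ` range ((+) m)"
      using that by (simp add: cycle_arcs_eq_range image_image)
    then show ?thesis using that by (auto simp: cycle_arcs_eq_range)
  qed
  \<comment> \<open>Rotating further by \<open>?k\<close> undoes \<open>rotate m\<close>, the total
    being a multiple of the length; this yields the converse inclusion.\<close>
  let ?k = "length xs * m - m"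
  have "m \<le> length xs * m" using False by (cases xs) auto
  then have "rotate ?k (rotate m xs) = xs"
    by (simp add: rotate_rotate rotate_id)
  then have "cycle_arcs xs \<subseteq> cycle_arcs (rotate m xs)"
    using sub[of "rotate m xs" ?k] False by simp
  with sub False show ?thesis by blast
qed simp

definition cyclic_lists :: "nat \<Rightarrow> ('a \<times> 'a) set \<Rightarrow> 'a list set" where
  "cyclic_lists l E = {xs. distinct xs \<and> length xs = l \<and> cycle_arcs xs \<subseteq> E}"

lemma directed_cycles_eq: "directed_cycles l E = cycle_arcs ` cyclic_lists l E"
  by (auto simp: directed_cycles_def cyclic_lists_def)

lemma finite_cyclic_lists:
  assumes "finite E"
  shows "finite (cyclic_lists l E)"
proof (rule finite_subset)
  show "cyclic_lists l E \<subseteq> {xs. set xs \<subseteq> fst ` E \<and> length xs = l}"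
    by (auto simp: cyclic_lists_def simp flip: fst_cycle_arcs)
  show "finite {xs. set xs \<subseteq> fst ` E \<and> length xs = l}"
    using assms by (intro finite_lists_length_eq) simp
qed

text \<open>Every fibre of \<open>cycle_arcs\<close> contains the \<open>l\<close> rotations of one
  list, which are distinct because they start at different vertices.\<close>

lemma card_directed_cycles_le_cyclic_lists:
  assumes "finite E"
  shows "l * card (directed_cycles l E) \<le> card (cyclic_lists l E)"
proof -
  let ?L = "cyclic_lists l E"
  have "l \<le> card {xs \<in> ?L. cycle_arcs xs = C}" if "C \<in> cycle_arcs ` ?L" for C
  proof -
    obtain xs where xs: "distinct xs" "length xs = l" "cycle_arcs xs \<subseteq> E" "C = cycle_arcs xs"
      using \<open>C \<in> cycle_arcs ` ?L\<close> by (auto simp: cyclic_lists_def)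
    have "inj_on (\<lambda>m. rotate m xs) {..<l}"
    proof (rule inj_onI)
      fix m m' assume m: "m \<in> {..<l}" "m' \<in> {..<l}" and eq: "rotate m xs = rotate m' xs"
      then have "xs ! m = xs ! m'"
        using nth_rotate[of 0 xs m] nth_rotate[of 0 xs m'] xs(2) by simp
      then show "m = m'" using m xs(1,2) by (simp add: nth_eq_iff_index_eq)
    qed
    then have "l = card ((\<lambda>m. rotate m xs) ` {..<l})"
      by (simp add: card_image)
    also have "\<dots> \<le> card {xs \<in> ?L. cycle_arcs xs = C}"
    proof (rule card_mono)
      show "finite {xs \<in> ?L. cycle_arcs xs = C}" using finite_cyclic_lists[OF assms] by simp
      show "(\<lambda>m. rotate m xs) ` {..<l} \<subseteq> {xs \<in> ?L. cycle_arcs xs = C}"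
        using xs by (auto simp: cyclic_lists_def cycle_arcs_rotate)
    qed
    finally show ?thesis .
  qed
  then have "l * card (directed_cycles l E) \<le> (\<Sum>C\<in>cycle_arcs ` ?L. card {xs \<in> ?L. cycle_arcs xs = C})"
    unfolding directed_cycles_eq
    using sum_mono[of "cycle_arcs ` ?L" "\<lambda>_. l"] by (simp add: mult.commute)
  also have "\<dots> = card ?L"
    using sum.image_gen[OF finite_cyclic_lists[OF assms], of "\<lambda>_. 1 :: nat" l cycle_arcs] by simp
  finally show ?thesis .
qed

text \<open>This is an entry of the \<open>k\<close>-th power of the matrix \<open>B\<close>, kept
  over the reals so that entries can be compared and signs used.\<close>

fun walk_weight :: "nat \<Rightarrow> (nat \<Rightarrow> nat \<Rightarrow> real) \<Rightarrow> nat \<Rightarrow> nat \<Rightarrow> nat \<Rightarrow> real" where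
  "walk_weight n B 0 i j = (if i = j then 1 else 0)"
| "walk_weight n B (Suc k) i j = (\<Sum>m<n. walk_weight n B k i m * B m j)"

lemma walk_weight_nonneg:
  assumes "\<And>i j. 0 \<le> B i j"
  shows "0 \<le> walk_weight n B k i j"
  using assms by (induction k arbitrary: j) (auto intro!: sum_nonneg)

definition walks :: "nat \<Rightarrow> ('a \<times> 'a) set \<Rightarrow> 'a \<Rightarrow> 'a \<Rightarrow> 'a list set" where
  "walks k E i j = {xs. length xs = Suc k \<and> hd xs = i \<and> last xs = j \<and> successively (\<lambda>a b. (a, b) \<in> E) xs}"

lemma walks_Suc: "walks (Suc k) E i j = (\<Union>m\<in>{m. (m, j) \<in> E}. (\<lambda>xs. xs @ [j]) ` walks k E i m)"
proof (intro equalityI subsetI)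
  fix xs assume xs: "xs \<in> walks (Suc k) E i j"
  then have "xs \<noteq> []" by (auto simp: walks_def)
  then obtain ys where ys: "xs = ys @ [j]"
    using xs by (cases xs rule: rev_cases) (auto simp: walks_def)
  with xs have "ys \<noteq> []" by (auto simp: walks_def)
  with xs ys have "(last ys, j) \<in> E" "ys \<in> walks k E i (last ys)"
    by (auto simp: walks_def successively_append_iff)
  with ys show "xs \<in> (\<Union>m\<in>{m. (m, j) \<in> E}. (\<lambda>xs. xs @ [j]) ` walks k E i m)" by auto
next
  fix xs assume "xs \<in> (\<Union>m\<in>{m. (m, j) \<in> E}. (\<lambda>xs. xs @ [j]) ` walks k E i m)"
  then obtain ys m where ys: "(m, j) \<in> E" "ys \<in> walks k E i m" "xs = ys @ [j]" by auto
  then have "ys \<noteq> []" by (auto simp: walks_def)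
  with ys show "xs \<in> walks (Suc k) E i j" by (auto simp: walks_def successively_append_iff)
qed

lemma finite_walks:
  assumes "finite E"
  shows "finite (walks k E i j)"
proof (induction k arbitrary: j)
  case 0
  have "walks 0 E i j \<subseteq> {[i]}" by (auto simp: walks_def length_Suc_conv)
  then show ?case by (rule finite_subset) simp
next
  case (Suc k)
  have "finite {m. (m, j) \<in> E}"
    by (rule finite_subset[of _ "fst ` E"]) (use assms in \<open>auto simp: rev_image_eqI\<close>)
  then show ?case using Suc by (simp add: walks_Suc)
qed

text \<open>\<open>B\<close> is nonnegative and dominates the adjacency matrix, so its powers
  dominate the walk counts: \<open>walks_Suc\<close> peels off the last vertex just as the recursion
  of \<open>walk_weight\<close> does.\<close>

lemma card_walks_le:
  fixes B :: "nat \<Rightarrow> nat \<Rightarrow> real"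
  assumes E: "E \<subseteq> {..<n} \<times> {..<n}" and B: "\<And>i j. 0 \<le> B i j" "\<And>i j. (i, j) \<in> E \<Longrightarrow> 1 \<le> B i j"
  shows "real (card (walks k E i j)) \<le> walk_weight n B k i j"
proof (induction k arbitrary: j)
  case 0
  have "walks 0 E i j = (if i = j then {[i]} else {})"
    by (auto simp: walks_def length_Suc_conv)
  then show ?case by simp
next
  case (Suc k)
  have fin: "finite {m. (m, j) \<in> E}"
    by (rule finite_subset[of _ "{..<n}"]) (use E in auto)
  have "card (walks (Suc k) E i j) \<le> (\<Sum>m | (m, j) \<in> E. card ((\<lambda>xs. xs @ [j]) ` walks k E i m))"
    unfolding walks_Suc by (rule card_UN_le[OF fin])
  also have "\<dots> = (\<Sum>m | (m, j) \<in> E. card (walks k E i m))"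
    by (intro sum.cong refl card_image) (simp add: inj_on_def)
  finally have "real (card (walks (Suc k) E i j)) \<le> (\<Sum>m | (m, j) \<in> E. real (card (walks k E i m)))"
    by (simp flip: of_nat_sum)
  also have "\<dots> \<le> (\<Sum>m | (m, j) \<in> E. walk_weight n B k i m * B m j)"
  proof (intro sum_mono)
    fix m assume "m \<in> {m. (m, j) \<in> E}"
    then have "1 \<le> B m j" using B(2) by blast
    then have "walk_weight n B k i m * 1 \<le> walk_weight n B k i m * B m j"
      by (intro mult_left_mono walk_weight_nonneg B(1))
    with Suc.IH[of m] show "real (card (walks k E i m)) \<le> walk_weight n B k i m * B m j" by simp
  qed
  also have "\<dots> \<le> (\<Sum>m<n. walk_weight n B k i m * B m j)"
    by (rule sum_mono2) (use E in \<open>auto intro!: mult_nonneg_nonneg walk_weight_nonneg B\<close>)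
  finally show ?case by simp
qed


text \<open>Appending the first vertex again maps cyclic lists injectively to closed walks.\<close>

lemma card_cyclic_lists_le_trace:
  fixes B :: "nat \<Rightarrow> nat \<Rightarrow> real"
  assumes E: "E \<subseteq> {..<n} \<times> {..<n}" and B: "\<And>i j. 0 \<le> B i j" "\<And>i j. (i, j) \<in> E \<Longrightarrow> 1 \<le> B i j"
    and l: "0 < l"
  shows "real (card (cyclic_lists l E)) \<le> (\<Sum>i<n. walk_weight n B l i i)"
proof -
  have fE: "finite E" using E by (rule finite_subset) simp
  have closed: "xs @ [hd xs] \<in> walks l E (hd xs) (hd xs)" "hd xs < n" if "xs \<in> cyclic_lists l E" for xs
  proof -
    have len: "length xs = l" and arcs: "cycle_arcs xs \<subseteq> E" using that by (auto simp: cyclic_lists_def)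
    have ne: "xs \<noteq> []" using len l by auto
    have arc: "(xs ! i, xs ! (Suc i mod l)) \<in> E" if "i < l" for i
      using arcs that len by (auto simp: cycle_arcs_def)
    have "successively (\<lambda>a b. (a, b) \<in> E) xs"
      unfolding successively_conv_nth using arc len by (metis Suc_lessD mod_less)
    \<comment> \<open>The closing arc has index \<open>l - 1\<close>, whose successor wraps around
      to 0.\<close>
    moreover have "(last xs, hd xs) \<in> E"
      using arc[of "l - 1"] l len ne by (simp add: last_conv_nth hd_conv_nth)
    ultimately show "xs @ [hd xs] \<in> walks l E (hd xs) (hd xs)" "hd xs < n"
      using len ne E by (auto simp: walks_def successively_append_iff)
  qed
  have "card (cyclic_lists l E) = card ((\<lambda>xs. xs @ [hd xs]) ` cyclic_lists l E)"
    by (rule card_image[symmetric]) (auto simp: inj_on_def)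
  also have "\<dots> \<le> card (\<Union>i\<in>{..<n}. walks l E i i)"
    by (rule card_mono) (use closed finite_walks[OF fE] in auto)
  also have "\<dots> \<le> (\<Sum>i<n. card (walks l E i i))"
    by (rule card_UN_le) simp
  finally have "real (card (cyclic_lists l E)) \<le> (\<Sum>i<n. real (card (walks l E i i)))"
    by (simp flip: of_nat_sum)
  also have "\<dots> \<le> (\<Sum>i<n. walk_weight n B l i i)"
    by (intro sum_mono card_walks_le E B)
  finally show ?thesis .
qed

subsection \<open>The limiting density\<close>

text \<open>Relabelling the vertices makes the maximum available for tournaments left after deleting
  a vertex, whose vertex set is no initial segment in general.\<close>

lemma card_directed_cycles_le_max:
  assumes "finite V" "card V = n" and T: "tournament V E"
  shows "card (directed_cycles l E) \<le> max_cycles n l"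
proof -
  obtain f where f: "bij_betw f V {..<n}"
    using assms(1,2) by (metis bij_betw_iff_card card_lessThan finite_lessThan)
  then have inj: "inj_on f V" and im: "f ` V = {..<n}" by (auto simp: bij_betw_def)
  let ?g = "map_prod f f"
  have EV: "E \<subseteq> V \<times> V" using T by (simp add: tournament_def)
  have injg: "inj_on ?g (V \<times> V)" using inj by (auto simp: inj_on_def)
  have T': "tournament {..<n} (?g ` E)"
    unfolding tournament_def
  proof (intro conjI)
    show "?g ` E \<subseteq> {..<n} \<times> {..<n}" using EV im by auto
    show "asym (?g ` E)"
    proof (rule asymI)
      fix x y assume "(x, y) \<in> ?g ` E"
      then obtain a b where ab: "(a, b) \<in> E" "x = f a" "y = f b" by auto
      show "(y, x) \<notin> ?g ` E"
      proof
        assume "(y, x) \<in> ?g ` E"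
        then obtain c d where cd: "(c, d) \<in> E" "y = f c" "x = f d" by auto
        have "c = b" "d = a" using ab cd EV inj by (auto dest: inj_onD)
        with ab cd show False using T by (auto simp: tournament_def dest: asymD)
      qed
    qed
    show "total_on {..<n} (?g ` E)"
    proof (rule total_onI)
      fix x y assume "x \<in> {..<n}" "y \<in> {..<n}" "x \<noteq> y"
      then obtain a b where ab: "a \<in> V" "b \<in> V" "x = f a" "y = f b" using im by (metis imageE)
      with \<open>x \<noteq> y\<close> have "(a, b) \<in> E \<or> (b, a) \<in> E"
        using T by (auto simp: tournament_def total_on_def)
      then show "(x, y) \<in> ?g ` E \<or> (y, x) \<in> ?g ` E" using ab by force
    qed
  qed
  have "directed_cycles l E \<subseteq> Pow (V \<times> V)"
    using EV by (auto simp: directed_cycles_def)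
  then have inj': "inj_on ((`) ?g) (directed_cycles l E)"
    using injg by (meson inj_on_image_Pow inj_on_subset)
  have "(`) ?g ` directed_cycles l E \<subseteq> directed_cycles l (?g ` E)"
  proof
    fix D assume "D \<in> (`) ?g ` directed_cycles l E"
    then obtain xs where xs: "distinct xs" "length xs = l" "cycle_arcs xs \<subseteq> E" "D = ?g ` cycle_arcs xs"
      by (auto simp: directed_cycles_def)
    have "set xs \<subseteq> V" using xs(3) EV by (auto simp flip: fst_cycle_arcs)
    then have "distinct (map f xs)" using xs(1) inj by (auto simp: distinct_map intro: inj_on_subset)
    moreover have "cycle_arcs (map f xs) = D" using xs(4) by (simp add: cycle_arcs_map)
    ultimately show "D \<in> directed_cycles l (?g ` E)"
      using xs image_mono[OF xs(3), of ?g] unfolding directed_cycles_def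
      by (auto intro!: exI[of _ "map f xs"])
  qed
  moreover have "finite (?g ` E)"
    using assms(1) EV by (meson finite_SigmaI finite_imageI finite_subset)
  ultimately have "card (directed_cycles l E) \<le> card (directed_cycles l (?g ` E))"
    using inj' by (intro card_inj_on_le[of "(`) ?g"] finite_directed_cycles)
  also have "\<dots> \<le> max_cycles n l"
    unfolding max_cycles_def using T' finite_tournaments[of "{..<n}"] by (intro Max_ge) auto
  finally show ?thesis .
qed

lemma max_cycles_attained:
  obtains E where "tournament {..<n} E" "max_cycles n l = card (directed_cycles l E)"
proof -
  have "max_cycles n l \<in> (\<lambda>E. card (directed_cycles l E)) ` {E. tournament {..<n} E}"
    unfolding max_cycles_def using finite_tournaments[of "{..<n}"] tournament_exists[of n]
    by (intro Max_in) auto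
  then show ?thesis using that by auto
qed

text \<open>Double count pairs of a vertex and a cycle avoiding it in an optimal tournament: each
  cycle avoids \<open>Suc n - l\<close> vertices, and deleting a vertex leaves at most
  \<open>max_cycles n l\<close> cycles.\<close>

lemma max_cycles_Suc_le: "(Suc n - l) * max_cycles (Suc n) l \<le> Suc n * max_cycles n l"
proof -
  obtain E where T: "tournament {..<Suc n} E" and max: "max_cycles (Suc n) l = card (directed_cycles l E)"
    by (rule max_cycles_attained)
  let ?D = "directed_cycles l E" and ?V = "{..<Suc n}"
  have EV: "E \<subseteq> ?V \<times> ?V" using T by (simp add: tournament_def)
  then have fE: "finite E" by (rule finite_subset) simp
  have le: "card {C \<in> ?D. v \<notin> fst ` C} \<le> max_cycles n l" if "v \<in> ?V" for v
  proof -
    let ?W = "?V - {v}"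
    have "tournament ?W (E \<inter> ?W \<times> ?W)"
      using T by (auto simp: tournament_def total_on_def intro!: asymI dest: asymD)
    moreover have "card ?W = n" using that by simp
    ultimately have "card (directed_cycles l (E \<inter> ?W \<times> ?W)) \<le> max_cycles n l"
      by (intro card_directed_cycles_le_max) auto
    moreover have "{C \<in> ?D. v \<notin> fst ` C} \<subseteq> directed_cycles l (E \<inter> ?W \<times> ?W)"
    proof
      fix C assume "C \<in> {C \<in> ?D. v \<notin> fst ` C}"
      then obtain xs where xs: "distinct xs" "length xs = l" "cycle_arcs xs \<subseteq> E" "C = cycle_arcs xs" "v \<notin> set xs"
        by (auto simp: directed_cycles_def fst_cycle_arcs)
      have "cycle_arcs xs \<subseteq> set xs \<times> set xs" by (auto simp: cycle_arcs_def intro!: nth_mem mod_less_divisor)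
      then show "C \<in> directed_cycles l (E \<inter> ?W \<times> ?W)"
        using xs EV unfolding directed_cycles_def by fastforce
    qed
    moreover have "finite (directed_cycles l (E \<inter> ?W \<times> ?W))"
      using fE by (intro finite_directed_cycles) simp
    ultimately show ?thesis by (meson card_mono le_trans)
  qed
  have "(\<Sum>C\<in>?D. card {v \<in> ?V. v \<notin> fst ` C}) = (\<Sum>C\<in>?D. Suc n - l)"
  proof (rule sum.cong[OF refl])
    fix C assume "C \<in> ?D"
    then obtain xs where xs: "distinct xs" "length xs = l" "cycle_arcs xs \<subseteq> E" "C = cycle_arcs xs"
      by (auto simp: directed_cycles_def)
    have "set xs \<subseteq> ?V" using xs(3) EV by (auto simp flip: fst_cycle_arcs)
    moreover have "{v \<in> ?V. v \<notin> fst ` C} = ?V - set xs" using xs by (auto simp: fst_cycle_arcs)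
    ultimately show "card {v \<in> ?V. v \<notin> fst ` C} = Suc n - l"
      using xs by (simp add: card_Diff_subset distinct_card)
  qed
  then have "(Suc n - l) * card ?D = (\<Sum>C\<in>?D. card {v \<in> ?V. v \<notin> fst ` C})" by simp
  also have "\<dots> = (\<Sum>v\<in>?V. card {C \<in> ?D. v \<notin> fst ` C})"
    using sum.swap_restrict[of ?D ?V "\<lambda>_ _. 1 :: nat" "\<lambda>C v. v \<notin> fst ` C"] fE
    by (simp add: finite_directed_cycles)
  also have "\<dots> \<le> (\<Sum>v\<in>?V. max_cycles n l)" by (intro sum_mono le)
  finally show ?thesis by (simp add: max)
qed

text \<open>The random count satisfies the recursion of \<open>max_cycles_Suc_le\<close> with
  equality, so the ratio of the two is nonincreasing.\<close>

lemma random_cycles_Suc: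
  assumes "l \<le> n"
  shows "random_cycles (Suc n) l * real (Suc n - l) = real (Suc n) * random_cycles n l"
proof -
  have "(Suc n choose l) * (Suc n - l) = Suc n * (n choose l)"
    using binomial_absorb_comp[of "Suc n" l] by (simp add: mult.commute)
  then have "real (Suc n choose l) * real (Suc n - l) = real (Suc n) * real (n choose l)"
    by (metis of_nat_mult)
  then show ?thesis by (simp add: random_cycles_def)
qed

lemma random_cycles_pos: "l \<le> n \<Longrightarrow> 0 < random_cycles n l"
  by (simp add: random_cycles_def)

lemma cycle_ratio_convergent: "convergent (\<lambda>n. real (max_cycles n l) / random_cycles n l)"
proof -
  let ?f = "\<lambda>n. real (max_cycles n l) / random_cycles n l"
  have "?f (Suc n) \<le> ?f n" if "l \<le> n" for n
  proof -
    have "real (Suc n - l) * real (max_cycles (Suc n) l) \<le> real (Suc n) * real (max_cycles n l)"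
      using max_cycles_Suc_le[of n l] by (metis of_nat_le_iff of_nat_mult)
    then have "real (Suc n - l) * real (max_cycles (Suc n) l) * random_cycles n l
        \<le> real (Suc n) * real (max_cycles n l) * random_cycles n l"
      by (rule mult_right_mono) (use random_cycles_pos[OF that] in simp)
    also have "\<dots> = real (max_cycles n l) * (random_cycles (Suc n) l * real (Suc n - l))"
      by (simp only: random_cycles_Suc[OF that] mult_ac)
    finally have "real (max_cycles (Suc n) l) * random_cycles n l \<le> real (max_cycles n l) * random_cycles (Suc n) l"
      using that by (simp add: mult_ac)
    then show ?thesis
      using random_cycles_pos[OF that] random_cycles_pos[of l "Suc n"] that by (simp add: divide_simps)
  qed
  \<comment> \<open>The shift by \<open>l\<close> skips the indices below \<open>l\<close>, where
    \<open>random_cycles\<close> is 0.\<close>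
  then have "decseq (\<lambda>n. ?f (n + l))"
    by (intro decseq_SucI) simp
  moreover have "0 \<le> ?f (n + l)" for n
    using random_cycles_pos[of l "n + l"] by simp
  ultimately obtain L where "(\<lambda>n. ?f (n + l)) \<longlonglongrightarrow> L"
    using decseq_convergent[of "\<lambda>n. ?f (n + l)" 0] by metis
  then have "?f \<longlonglongrightarrow> L" by (rule LIMSEQ_offset)
  then show ?thesis by (auto simp: convergent_def)
qed

lemma fact_binomial_asymptotic: "(\<lambda>n. real n ^ l / (fact l * real (n choose l))) \<longlonglongrightarrow> 1"
proof -
  have "(\<lambda>n. \<Prod>i=0..<l. 1 - real i / real n) \<longlonglongrightarrow> (\<Prod>i=0..<l. 1 - 0)"
    by (intro tendsto_prod tendsto_diff tendsto_const lim_const_over_n)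
  then have "(\<lambda>n. inverse (\<Prod>i=0..<l. 1 - real i / real n)) \<longlonglongrightarrow> inverse 1"
    by (intro tendsto_inverse) simp_all
  moreover have "inverse (\<Prod>i=0..<l. 1 - real i / real n) = real n ^ l / (fact l * real (n choose l))"
    if "0 < n" for n
  proof -
    have "fact l * real (n choose l) = (\<Prod>i=0..<l. real n - real i)"
      by (simp add: binomial_gbinomial gbinomial_mult_fact)
    also have "\<dots> = (\<Prod>i=0..<l. real n * (1 - real i / real n))"
      using that by (intro prod.cong refl) (simp add: field_simps)
    also have "\<dots> = real n ^ l * (\<Prod>i=0..<l. 1 - real i / real n)"
      by (simp add: prod.distrib)
    finally show ?thesis using that by (simp add: field_simps)
  qed
  then have "eventually (\<lambda>n. inverse (\<Prod>i=0..<l. 1 - real i / real n) = real n ^ l / (fact l * real (n choose l))) sequentially"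
    by (intro eventually_sequentiallyI[of 1]) simp
  ultimately show ?thesis
    by (simp add: tendsto_cong)
qed

text \<open>For fixed \<open>l\<close>, \<open>l * random_cycles n l\<close> is asymptotic to
  \<open>(n / 2) ^ l\<close>, so a bound uniform in \<open>n\<close> passes to the limit.\<close>

lemma cycle_density_le:
  assumes "0 < l"
    and "\<And>n. 0 < n \<Longrightarrow> real l * real (max_cycles n l) \<le> K * (real n / 2) ^ l"
  shows "cycle_density l \<le> K"
proof -
  let ?f = "\<lambda>n. real (max_cycles n l) / random_cycles n l"
  have "?f \<longlonglongrightarrow> cycle_density l"
    unfolding cycle_density_def using cycle_ratio_convergent by (simp add: convergent_LIMSEQ_iff)
  moreover have "(\<lambda>n. K * (real n ^ l / (fact l * real (n choose l)))) \<longlonglongrightarrow> K * 1"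
    by (intro tendsto_mult_left fact_binomial_asymptotic)
  moreover have "?f n \<le> K * (real n ^ l / (fact l * real (n choose l)))" if "n \<ge> max 1 l" for n
  proof -
    have pos: "0 < real (n choose l)" using that by simp
    have fact: "fact l = real l * fact (l - 1)" using assms(1) by (simp add: fact_reduce)
    have "?f n = real l * real (max_cycles n l) * 2 ^ l / (fact l * real (n choose l))"
      using assms(1) by (simp add: random_cycles_def fact)
    also have "\<dots> \<le> K * (real n / 2) ^ l * 2 ^ l / (fact l * real (n choose l))"
      using assms(2)[of n] that pos by (intro divide_right_mono mult_right_mono) auto
    also have "\<dots> = K * (real n ^ l / (fact l * real (n choose l)))"
      by (simp add: power_divide)
    finally show ?thesis .
  qed
  ultimately show ?thesis
    by (metis (no_types, lifting) LIMSEQ_le mult.right_neutral)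
qed

subsection \<open>Traces of matrix powers\<close>

definition mat_trace :: "'a :: comm_monoid_add mat \<Rightarrow> 'a" where
  "mat_trace A = (\<Sum>i<dim_row A. A $$ (i, i))"

lemma mat_trace_mult_commute:
  fixes A B :: "'a :: comm_semiring_0 mat"
  assumes "A \<in> carrier_mat n n" "B \<in> carrier_mat n n"
  shows "mat_trace (A * B) = mat_trace (B * A)"
proof -
  have tr: "mat_trace (X * Y) = (\<Sum>i<n. \<Sum>j<n. X $$ (i, j) * Y $$ (j, i))"
    if "X \<in> carrier_mat n n" "Y \<in> carrier_mat n n" for X Y :: "'a mat"
    using that by (auto simp: mat_trace_def scalar_prod_def atLeast0LessThan)
  show ?thesis
    unfolding tr[OF assms] tr[OF assms(2,1)] by (subst sum.swap) (simp add: mult.commute)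
qed

lemma mat_trace_similar:
  fixes A B :: "'a :: comm_semiring_1 mat"
  assumes "similar_mat_wit A B P Q"
  shows "mat_trace A = mat_trace B"
proof -
  note w = similar_mat_witD[OF refl assms]
  have "mat_trace A = mat_trace (Q * (P * B))"
    using w by (metis mat_trace_mult_commute mult_carrier_mat)
  also have "Q * (P * B) = B"
    using w by (metis assoc_mult_mat left_mult_one_mat)
  finally show ?thesis .
qed

lemma upper_triangular_pow:
  fixes B :: "'a :: comm_semiring_1 mat"
  assumes B: "B \<in> carrier_mat n n" "upper_triangular B"
  shows "upper_triangular (B ^\<^sub>m k) \<and> (\<forall>i<n. (B ^\<^sub>m k) $$ (i, i) = B $$ (i, i) ^ k)"
proof (induction k)
  case 0
  then show ?case using B by auto
next
  case (Suc k)
  let ?C = "B ^\<^sub>m k"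
  have C: "?C \<in> carrier_mat n n" using B by simp
  have ix: "(?C * B) $$ (i, j) = (\<Sum>m<n. ?C $$ (i, m) * B $$ (m, j))" if "i < n" "j < n" for i j
    using that B C by (auto simp: scalar_prod_def atLeast0LessThan)
  have zC: "?C $$ (i, m) = 0" if "m < i" "i < n" for i m
    using Suc that C by (auto elim!: upper_triangularD)
  have zB: "B $$ (i, m) = 0" if "m < i" "i < n" for i m
    using B that by auto
  \<comment> \<open>In each product either \<open>m < i\<close>, and the first factor vanishes, or
    \<open>j < i \<le> m\<close>, and the second does.\<close>
  have "(?C * B) $$ (i, j) = 0" if "j < i" "i < n" for i j
    using that zC zB by (auto simp: ix intro!: sum.neutral) (metis mult_zero_left mult_zero_right linorder_not_le order_le_less_trans)
  moreover have "(?C * B) $$ (i, i) = B $$ (i, i) ^ Suc k" if "i < n" for i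
  proof -
    have "(?C * B) $$ (i, i) = (\<Sum>m<n. if m = i then ?C $$ (i, i) * B $$ (i, i) else 0)"
      unfolding ix[OF that that]
    proof (intro sum.cong refl)
      fix m assume "m \<in> {..<n}"
      then show "?C $$ (i, m) * B $$ (m, i) = (if m = i then ?C $$ (i, i) * B $$ (i, i) else 0)"
        using zC[of m i] zB[of i m] that by (cases m i rule: linorder_cases) auto
    qed
    then show ?thesis using Suc that by (simp add: mult.commute)
  qed
  ultimately show ?case using B C by auto
qed

text \<open>By Schur triangularisation \<open>e\<close> is the diagonal of a similar triangular
  matrix; it lists the eigenvalues with algebraic multiplicity, and powers act on it
  entrywise.\<close>

lemma complex_mat_spectrum:
  fixes A :: "complex mat"
  assumes A: "A \<in> carrier_mat n n"
  obtains e where "\<And>x. eigenvalue A x \<longleftrightarrow> (\<exists>i<n. x = e i)"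
    "\<And>k. mat_trace (A ^\<^sub>m k) = (\<Sum>i<n. e i ^ k)"
proof -
  obtain es where es: "char_poly A = (\<Prod>a\<leftarrow>es. [:- a, 1:])"
    using char_poly_factorized[OF A] by blast
  obtain B P Q where "schur_decomposition A es = (B, P, Q)"
    by (cases "schur_decomposition A es")
  from schur_decomposition[OF A es this]
  have sim: "similar_mat_wit A B P Q" and up: "upper_triangular B" and diag: "diag_mat B = es"
    by auto
  have B: "B \<in> carrier_mat n n" using similar_mat_witD2[OF A sim] by simp
  have "eigenvalue A x \<longleftrightarrow> x \<in> set es" for x
    unfolding eigenvalue_root_char_poly[OF A] es by (auto simp: poly_prod_list o_def prod_list_zero_iff)
  also have "x \<in> set es \<longleftrightarrow> (\<exists>i<n. x = B $$ (i, i))" for x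
    using B unfolding diag[symmetric] by (auto simp: diag_mat_def)
  finally have ev: "eigenvalue A x \<longleftrightarrow> (\<exists>i<n. x = B $$ (i, i))" for x .
  have "mat_trace (A ^\<^sub>m k) = (\<Sum>i<n. (B $$ (i, i)) ^ k)" for k
  proof -
    have "mat_trace (A ^\<^sub>m k) = mat_trace (B ^\<^sub>m k)"
      by (rule mat_trace_similar[OF similar_mat_wit_pow[OF sim]])
    also have "\<dots> = (\<Sum>i<n. (B $$ (i, i)) ^ k)"
      using upper_triangular_pow[OF B up, of k] B by (simp add: mat_trace_def)
    finally show ?thesis .
  qed
  with ev show ?thesis by (rule that)
qed

lemma mat_pow_walk_weight:
  assumes "i < n" "j < n"
  shows "(mat n n (\<lambda>(i, j). complex_of_real (B i j)) ^\<^sub>m k) $$ (i, j) = of_real (walk_weight n B k i j)"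
  using assms
proof (induction k arbitrary: j)
  case (Suc k)
  let ?M = "mat n n (\<lambda>(i, j). complex_of_real (B i j))"
  have "(?M ^\<^sub>m Suc k) $$ (i, j) = (\<Sum>m<n. (?M ^\<^sub>m k) $$ (i, m) * ?M $$ (m, j))"
    using Suc.prems by (simp add: scalar_prod_def atLeast0LessThan)
  also have "\<dots> = of_real (walk_weight n B (Suc k) i j)"
    using Suc by simp
  finally show ?case .
qed simp

text \<open>Eigenvectors are encoded as functions on the indices below \<open>n\<close>, so that
  quadratic forms become plain double sums.\<close>

definition fun_eigen :: "nat \<Rightarrow> (nat \<Rightarrow> nat \<Rightarrow> real) \<Rightarrow> (nat \<Rightarrow> complex) \<Rightarrow> complex \<Rightarrow> bool" where
  "fun_eigen n B w x \<longleftrightarrow> (\<exists>i<n. w i \<noteq> 0) \<and> (\<forall>i<n. (\<Sum>j<n. of_real (B i j) * w j) = x * w i)"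

lemma eigenvalue_iff_fun_eigen:
  "eigenvalue (mat n n (\<lambda>(i, j). complex_of_real (B i j))) x \<longleftrightarrow> (\<exists>w. fun_eigen n B w x)"
proof -
  let ?M = "mat n n (\<lambda>(i, j). complex_of_real (B i j))"
  have iff: "eigenvector ?M v x \<longleftrightarrow> fun_eigen n B (($) v) x" if "v \<in> carrier_vec n" for v
    using that by (auto simp: eigenvector_def fun_eigen_def vec_eq_iff scalar_prod_def atLeast0LessThan)
  show ?thesis
  proof
    assume "eigenvalue ?M x"
    then obtain v where v: "eigenvector ?M v x" by (auto simp: eigenvalue_def)
    then have "v \<in> carrier_vec n" by (simp add: eigenvector_def)
    with v iff show "\<exists>w. fun_eigen n B w x" by blast
  next
    assume "\<exists>w. fun_eigen n B w x"
    then obtain w where w: "fun_eigen n B w x" ..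
    then have "fun_eigen n B (($) (vec n w)) x" by (auto simp: fun_eigen_def)
    then show "eigenvalue ?M x"
      using iff[of "vec n w"] by (auto simp: eigenvalue_def)
  qed
qed

text \<open>Since \<open>B\<close> is real, eigenvalues come with their conjugates, as
  \<open>power_sum_le\<close> requires.\<close>

lemma fun_eigen_cnj:
  assumes "fun_eigen n B w x"
  shows "fun_eigen n B (\<lambda>i. cnj (w i)) (cnj x)"
proof -
  have "(\<Sum>j<n. of_real (B i j) * cnj (w j)) = cnj x * cnj (w i)" if "i < n" for i
  proof -
    have "cnj (\<Sum>j<n. of_real (B i j) * w j) = cnj (x * w i)"
      using assms that by (simp add: fun_eigen_def)
    then show ?thesis by simp
  qed
  then show ?thesis using assms by (auto simp: fun_eigen_def)
qed

subsection \<open>The spectrum of a tournament\<close>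

text \<open>The quadratic form \<open>Q\<close> at the eigenvector is \<open>x\<close> times the
  squared norm \<open>W\<close>. Its Hermitian part comes from half the all-ones matrix, hence is
  nonnegative; the antisymmetric part of \<open>B\<close> has entries of modulus at most 1/2, so
  \<open>sum_abs_Im_le\<close> controls the imaginary part.\<close>

lemma tournament_eigenvalue_bounds:
  fixes B :: "nat \<Rightarrow> nat \<Rightarrow> real"
  assumes B: "\<And>i j. i < n \<Longrightarrow> j < n \<Longrightarrow> B i j + B j i = 1" "\<And>i j. 0 \<le> B i j"
    and w: "fun_eigen n B w x"
  shows "0 \<le> Re x" "\<bar>Im x\<bar> \<le> real n / pi"
proof -
  define W where "W = (\<Sum>i<n. (cmod (w i))\<^sup>2)"
  define Q where "Q = (\<Sum>i<n. \<Sum>j<n. of_real (B i j) * (cnj (w i) * w j))"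
  obtain i0 where "i0 < n" "w i0 \<noteq> 0" using w by (auto simp: fun_eigen_def)
  then have "0 < W" unfolding W_def by (intro sum_pos2[of _ i0]) auto
  have "Q = (\<Sum>i<n. cnj (w i) * (\<Sum>j<n. of_real (B i j) * w j))"
    by (simp add: Q_def sum_distrib_left mult_ac)
  also have "\<dots> = (\<Sum>i<n. cnj (w i) * (x * w i))"
    using w by (simp add: fun_eigen_def)
  also have "\<dots> = x * of_real W"
    unfolding W_def of_real_sum complex_norm_square by (simp add: sum_distrib_left mult_ac)
  finally have Q: "Q = x * of_real W" .
  have Q': "cnj Q = (\<Sum>i<n. \<Sum>j<n. of_real (B j i) * (cnj (w i) * w j))"
    unfolding Q_def by (subst sum.swap) (simp add: mult_ac)
  have "Q + cnj Q = (\<Sum>i<n. \<Sum>j<n. of_real (B i j + B j i) * (cnj (w i) * w j))"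
    unfolding Q' by (simp only: Q_def sum.distrib[symmetric] of_real_add distrib_right)
  also have "\<dots> = (\<Sum>i<n. \<Sum>j<n. cnj (w i) * w j)"
    using B(1) by simp
  also have "\<dots> = cnj (\<Sum>i<n. w i) * (\<Sum>i<n. w i)"
    by (simp add: sum_product)
  also have "\<dots> = of_real ((cmod (\<Sum>i<n. w i))\<^sup>2)"
    by (simp only: complex_norm_square mult.commute)
  finally have "2 * (Re x * W) = (cmod (\<Sum>i<n. w i))\<^sup>2"
    unfolding complex_add_cnj Q of_real_eq_iff by simp
  then have "0 \<le> Re x * W" using zero_le_power2[of "cmod (\<Sum>i<n. w i)"] by linarith
  then show "0 \<le> Re x" using \<open>0 < W\<close> by (simp add: zero_le_mult_iff)

  have "2 * Im Q = Im (Q - cnj Q)" by simp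
  also have "Q - cnj Q = (\<Sum>i<n. \<Sum>j<n. of_real (B i j - B j i) * (cnj (w i) * w j))"
    unfolding Q' by (simp only: Q_def sum_subtractf[symmetric] of_real_diff left_diff_distrib)
  also have "Im \<dots> = (\<Sum>i<n. \<Sum>j<n. (B i j - B j i) * Im (cnj (w i) * w j))"
    unfolding Im_sum by (intro sum.cong refl) simp
  finally have "2 * \<bar>Im Q\<bar> = \<bar>\<Sum>i<n. \<Sum>j<n. (B i j - B j i) * Im (cnj (w i) * w j)\<bar>"
    by linarith
  also have "\<dots> \<le> (\<Sum>i<n. \<Sum>j<n. \<bar>Im (cnj (w i) * w j)\<bar>)"
  proof -
    have "\<bar>(B i j - B j i) * Im (cnj (w i) * w j)\<bar> \<le> \<bar>Im (cnj (w i) * w j)\<bar>" if "i < n" "j < n" for i j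
    proof -
      have "\<bar>B i j - B j i\<bar> \<le> 1" using B(1)[OF that] B(2)[of i j] B(2)[of j i] by linarith
      then show ?thesis unfolding abs_mult by (intro mult_left_le_one_le) auto
    qed
    then show ?thesis
      by (intro order_trans[OF sum_abs] sum_mono) auto
  qed
  also have "\<dots> \<le> 2 / pi * (\<Sum>i<n. cmod (w i))\<^sup>2"
    by (rule sum_abs_Im_le)
  \<comment> \<open>Cauchy-Schwarz.\<close>
  also have "\<dots> \<le> 2 / pi * (W * real n)"
    using sum_squared_le_sum_of_squares[of "\<lambda>i. cmod (w i)" "{..<n}"]
    unfolding W_def by (intro mult_left_mono) auto
  finally have "\<bar>Im x\<bar> * W \<le> real n / pi * W"
    using \<open>0 < W\<close> by (simp add: Q abs_mult field_simps)
  then show "\<bar>Im x\<bar> \<le> real n / pi" using \<open>0 < W\<close> by (rule mult_right_le_imp_le)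
qed

text \<open>Two of the \<open>m + 2\<close> factors are spent on the sum of squared moduli, at most
  \<open>s\<^sup>2 / 2\<close>; the other \<open>m\<close> are bounded by the largest modulus. The
  alternatives correspond to the presence or absence of a real part above
  \<open>(1 / 2 - \<delta>) * s\<close>.\<close>

lemma power_sum_le:
  fixes e :: "'a \<Rightarrow> complex"
  assumes "finite I" and s: "0 \<le> s"
    and Re: "\<And>i. i \<in> I \<Longrightarrow> 0 \<le> Re (e i)" and Im: "\<And>i. i \<in> I \<Longrightarrow> \<bar>Im (e i)\<bar> \<le> s / pi"
    and cnj: "\<And>i. i \<in> I \<Longrightarrow> \<exists>j\<in>I. e j = cnj (e i)"
    and sum: "(\<Sum>i\<in>I. Re (e i)) = s / 2" and sum2: "0 \<le> (\<Sum>i\<in>I. Re (e i ^ 2))"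
    and \<delta>: "0 < \<delta>" "\<delta> \<le> 1 / 20"
  shows "Re (\<Sum>i\<in>I. e i ^ (m + 2)) \<le> (s / 2) ^ (m + 2) + s\<^sup>2 / 2 * ((1 / pi + \<delta>) * s) ^ m \<or>
    Re (\<Sum>i\<in>I. e i ^ (m + 2)) \<le> s\<^sup>2 / 2 * ((1 / 2 - \<delta>) * s) ^ m"
proof -
  let ?q = "(1 / 2 - \<delta>) * s"
  have two: "Re (e i) + Re (e j) \<le> s / 2" if "i \<in> I" "j \<in> I" "i \<noteq> j" for i j
  proof -
    have "(\<Sum>i\<in>{i, j}. Re (e i)) \<le> (\<Sum>i\<in>I. Re (e i))"
      using that Re \<open>finite I\<close> by (intro sum_mono2) auto
    then show ?thesis using that sum by simp
  qed
  have one: "Re (e i) \<le> s / 2" if "i \<in> I" for i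
    using member_le_sum[of i I "\<lambda>i. Re (e i)"] that Re \<open>finite I\<close> sum by simp
  have norm2: "(\<Sum>i\<in>I. (cmod (e i))\<^sup>2) \<le> s\<^sup>2 / 2"
  proof -
    \<comment> \<open>Pointwise, the squared modulus is twice the squared real part minus the real
      part of the square.\<close>
    have "(\<Sum>i\<in>I. (cmod (e i))\<^sup>2) = 2 * (\<Sum>i\<in>I. (Re (e i))\<^sup>2) - (\<Sum>i\<in>I. Re (e i ^ 2))"
      by (simp add: cmod_power2 Re_power2 sum.distrib sum_subtractf)
    also have "\<dots> \<le> 2 * (\<Sum>i\<in>I. (Re (e i))\<^sup>2)" using sum2 by simp
    also have "(\<Sum>i\<in>I. (Re (e i))\<^sup>2) \<le> (\<Sum>i\<in>I. s / 2 * Re (e i))"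
      unfolding power2_eq_square by (intro sum_mono mult_right_mono one Re)
    also have "\<dots> = s / 2 * (s / 2)" by (simp only: sum_distrib_left[symmetric] sum)
    finally show ?thesis by (simp add: power2_eq_square)
  qed
  \<comment> \<open>A nonreal eigenvalue shares the trace with its conjugate, so its real part is at most \<open>s / 4\<close>;
    this replaces the Perron--Frobenius theorem.\<close>
  have nonreal: "cmod (e i) \<le> ?q" if i: "i \<in> I" and "Im (e i) \<noteq> 0" for i
  proof -
    obtain j where j: "j \<in> I" "e j = cnj (e i)" using cnj[OF i] by blast
    with \<open>Im (e i) \<noteq> 0\<close> have "i \<noteq> j" by (auto simp: complex_eq_iff)
    with two[OF i j(1)] j have "Re (e i) \<le> s / 4" by simp
    then have "(Re (e i))\<^sup>2 \<le> (s / 4)\<^sup>2" using Re[OF i] by (intro power_mono)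
    moreover have "\<bar>Im (e i)\<bar> \<le> s / 3"
      using Im[OF i] divide_left_mono[of 3 pi s] s pi_gt3 by linarith
    then have "(Im (e i))\<^sup>2 \<le> (s / 3)\<^sup>2" by (metis abs_ge_zero power2_abs power_mono)
    ultimately have "(cmod (e i))\<^sup>2 \<le> (s / 4)\<^sup>2 + (s / 3)\<^sup>2" by (simp add: cmod_power2)
    \<comment> \<open>The exact root is \<open>5 / 12 * s\<close>; the rounder \<open>9 / 20\<close>
      equals \<open>1 / 2 - 1 / 20\<close>, which explains the bound on
      \<open>\<delta>\<close>.\<close>
    also have "\<dots> \<le> (9 / 20 * s)\<^sup>2" by (simp add: power2_eq_square)
    finally have "cmod (e i) \<le> 9 / 20 * s" using s by (auto intro: power2_le_imp_le)
    also have "\<dots> \<le> ?q" using \<delta> s by (intro mult_right_mono) auto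
    finally show ?thesis .
  qed
  have bound: "Re (\<Sum>i\<in>J. e i ^ (m + 2)) \<le> s\<^sup>2 / 2 * t ^ m"
    if "J \<subseteq> I" "0 \<le> t" "\<And>i. i \<in> J \<Longrightarrow> cmod (e i) \<le> t" for J t
  proof -
    have "Re (\<Sum>i\<in>J. e i ^ (m + 2)) \<le> (\<Sum>i\<in>J. cmod (e i ^ (m + 2)))"
      using complex_Re_le_cmod norm_sum order_trans by blast
    also have "\<dots> \<le> (\<Sum>i\<in>J. t ^ m * (cmod (e i))\<^sup>2)"
      unfolding power_add norm_mult norm_power using that by (intro sum_mono mult_right_mono power_mono) auto
    also have "\<dots> = t ^ m * (\<Sum>i\<in>J. (cmod (e i))\<^sup>2)" by (simp add: sum_distrib_left)
    also have "\<dots> \<le> t ^ m * (\<Sum>i\<in>I. (cmod (e i))\<^sup>2)"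
      using that \<open>finite I\<close> by (intro mult_left_mono sum_mono2) auto
    also have "\<dots> \<le> t ^ m * (s\<^sup>2 / 2)"
      using norm2 that by (intro mult_left_mono) auto
    finally show ?thesis by (simp add: mult.commute)
  qed
  show ?thesis
  proof (cases "\<exists>i\<in>I. ?q < Re (e i)")
    case True
    then obtain i0 where i0: "i0 \<in> I" "?q < Re (e i0)" by blast
    then have "Im (e i0) = 0"
      using nonreal[OF i0(1)] complex_Re_le_cmod[of "e i0"] by fastforce
    then have "cmod (e i0) \<le> s / 2" using one[OF i0(1)] Re[OF i0(1)] by (simp add: cmod_def)
    then have lead: "Re (e i0 ^ (m + 2)) \<le> (s / 2) ^ (m + 2)"
      by (metis complex_Re_le_cmod norm_ge_zero norm_power order_trans power_mono)
    have "cmod (e i) \<le> (1 / pi + \<delta>) * s" if "i \<in> I - {i0}" for i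
    proof -
      \<comment> \<open>The dominant eigenvalue leaves less than \<open>s / 2 - ?q\<close> of the
        trace to the others.\<close>
      have "Re (e i) \<le> \<delta> * s" using two[of i i0] that i0 by (simp add: algebra_simps)
      then show ?thesis
        using cmod_le[of "e i"] Re[of i] Im[of i] that by (simp add: algebra_simps)
    qed
    then have "Re (\<Sum>i\<in>I - {i0}. e i ^ (m + 2)) \<le> s\<^sup>2 / 2 * ((1 / pi + \<delta>) * s) ^ m"
      using s \<delta> by (intro bound) auto
    moreover have "(\<Sum>i\<in>I. e i ^ (m + 2)) = e i0 ^ (m + 2) + (\<Sum>i\<in>I - {i0}. e i ^ (m + 2))"
      by (rule sum.remove[OF \<open>finite I\<close> i0(1)])
    ultimately show ?thesis using lead by simp
  next
    case False
    have "cmod (e i) \<le> ?q" if "i \<in> I" for i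
    proof (cases "Im (e i) = 0")
      case True
      then show ?thesis using False that Re[OF that] by (auto simp: cmod_def not_less)
    qed (use nonreal that in blast)
    then show ?thesis using s \<delta> by (intro disjI2 bound) auto
  qed
qed

section \<open>From the spectrum to the cycle counts and the density\<close>

lemma max_cycles_le:
  assumes \<delta>: "0 < \<delta>" "\<delta> \<le> 1 / 20"
  shows "real (m + 2) * real (max_cycles n (m + 2))
    \<le> (1 + 2 * (2 / pi + 2 * \<delta>) ^ m) * (real n / 2) ^ (m + 2) \<or>
   real (m + 2) * real (max_cycles n (m + 2)) \<le> (2 * (1 - 2 * \<delta>) ^ m) * (real n / 2) ^ (m + 2)"
proof -
  let ?l = "m + 2"
  obtain E where T: "tournament {..<n} E" and max: "max_cycles n ?l = card (directed_cycles ?l E)"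
    by (rule max_cycles_attained)
  have EV: "E \<subseteq> {..<n} \<times> {..<n}" and asym: "\<And>i j. (i, j) \<in> E \<Longrightarrow> (j, i) \<notin> E"
    and total: "\<And>i j. i < n \<Longrightarrow> j < n \<Longrightarrow> i \<noteq> j \<Longrightarrow> (i, j) \<in> E \<or> (j, i) \<in> E"
    using T by (auto simp: tournament_def total_on_def dest: asymD)
  \<comment> \<open>The diagonal entries \<open>1 / 2\<close> only add walks, and make \<open>B\<close> plus its transpose the all-ones matrix.\<close>
  define B :: "nat \<Rightarrow> nat \<Rightarrow> real" where "B i j = (if i = j then 1 / 2 else if (i, j) \<in> E then 1 else 0)" for i j
  have B: "\<And>i j. i < n \<Longrightarrow> j < n \<Longrightarrow> B i j + B j i = 1" "\<And>i j. 0 \<le> B i j" "\<And>i j. (i, j) \<in> E \<Longrightarrow> 1 \<le> B i j"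
    using asym total by (auto simp: B_def)
  define M where "M = mat n n (\<lambda>(i, j). complex_of_real (B i j))"
  have "M \<in> carrier_mat n n" by (simp add: M_def)
  then obtain e where ev: "\<And>x. eigenvalue M x \<longleftrightarrow> (\<exists>i<n. x = e i)"
    and tr: "\<And>k. mat_trace (M ^\<^sub>m k) = (\<Sum>i<n. e i ^ k)"
    by (rule complex_mat_spectrum) blast
  have eig: "\<exists>w. fun_eigen n B w (e i)" if "i < n" for i
    using ev[of "e i"] that unfolding M_def eigenvalue_iff_fun_eigen by blast
  have trace: "(\<Sum>i<n. e i ^ k) = of_real (\<Sum>i<n. walk_weight n B k i i)" for k
    unfolding tr[symmetric] M_def by (simp add: mat_trace_def mat_pow_walk_weight)
  then have ReTr: "Re (\<Sum>i<n. e i ^ k) = (\<Sum>i<n. walk_weight n B k i i)" for k by simp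
  have lower: "real ?l * real (max_cycles n ?l) \<le> Re (\<Sum>i<n. e i ^ ?l)"
  proof -
    have "finite E" using EV by (rule finite_subset) simp
    then have "real (?l * card (directed_cycles ?l E)) \<le> real (card (cyclic_lists ?l E))"
      using card_directed_cycles_le_cyclic_lists of_nat_le_iff by blast
    also have "\<dots> \<le> (\<Sum>i<n. walk_weight n B ?l i i)"
      by (intro card_cyclic_lists_le_trace EV B) auto
    finally show ?thesis unfolding ReTr max of_nat_mult .
  qed
  have upper: "Re (\<Sum>i<n. e i ^ ?l) \<le> (real n / 2) ^ ?l + (real n)\<^sup>2 / 2 * ((1 / pi + \<delta>) * real n) ^ m \<or>
    Re (\<Sum>i<n. e i ^ ?l) \<le> (real n)\<^sup>2 / 2 * ((1 / 2 - \<delta>) * real n) ^ m"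
  proof (rule power_sum_le[OF _ _ _ _ _ _ _ \<delta>])
    fix i assume "i \<in> {..<n}"
    then obtain w where w: "fun_eigen n B w (e i)" using eig by auto
    show "0 \<le> Re (e i)" "\<bar>Im (e i)\<bar> \<le> real n / pi"
      using tournament_eigenvalue_bounds[OF B(1,2) w] by auto
    show "\<exists>j\<in>{..<n}. e j = cnj (e i)"
      using fun_eigen_cnj[OF w] ev[of "cnj (e i)"] unfolding M_def eigenvalue_iff_fun_eigen by fastforce
  next
    have "walk_weight n B (Suc 0) i i = 1 / 2" if "i < n" for i
      using that by (simp add: B_def if_distrib[of "\<lambda>x. x * _"] cong: if_cong)
    then have "(\<Sum>i<n. walk_weight n B (Suc 0) i i) = (\<Sum>i<n. 1 / 2)"
      by (intro sum.cong) auto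
    then show "(\<Sum>i<n. Re (e i)) = real n / 2"
      using ReTr[of "Suc 0"] by simp
    \<comment> \<open>This is the trace of the square of a matrix with nonnegative entries.\<close>
    show "0 \<le> (\<Sum>i<n. Re (e i ^ 2))"
      using ReTr[of 2] by (simp add: sum_nonneg walk_weight_nonneg B(2))
  qed auto
  \<comment> \<open>Normalising by \<open>(n / 2) ^ (m + 2)\<close> doubles the bases, so
    \<open>1 / pi\<close> becomes \<open>2 / pi\<close> and \<open>1 / 2\<close> becomes 1.\<close>
  have "(real n)\<^sup>2 / 2 * (c * real n) ^ m = 2 * (2 * c) ^ m * (real n / 2) ^ ?l" for c
    by (simp add: power_add power_mult_distrib power_divide power2_eq_square)
  from this[of "1 / pi + \<delta>"] this[of "1 / 2 - \<delta>"] lower upper show ?thesis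
    by (auto simp: algebra_simps)
qed

theorem theorem16:
  "\<forall>\<epsilon>::real. \<epsilon> > 0 \<longrightarrow>
     (\<exists>l0::nat. \<forall>l\<ge>l0. 4 dvd l \<longrightarrow> cycle_density l \<le> 1 + (2 / pi + \<epsilon>) ^ l)"
proof (intro allI impI)
  fix \<epsilon> :: real assume "0 < \<epsilon>"
  \<comment> \<open>The first bound gives \<open>2 * \<delta> < \<epsilon>\<close>, hence
    \<open>a < b\<close>; the second is the one required by \<open>max_cycles_le\<close>.\<close>
  define \<delta> where "\<delta> = min (\<epsilon> / 4) (1 / 20)"
  define a where "a = 2 / pi + 2 * \<delta>"
  define b where "b = 2 / pi + \<epsilon>"
  have \<delta>: "0 < \<delta>" "\<delta> \<le> 1 / 20" "2 * \<delta> < \<epsilon>" using \<open>0 < \<epsilon>\<close> by (auto simp: \<delta>_def)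
  have "0 < a" "a < b" using \<delta> by (auto simp: a_def b_def add_pos_pos)
  then have "(\<lambda>m. 2 * (a / b) ^ m) \<longlonglongrightarrow> 2 * 0" "0 < b\<^sup>2"
    by (auto intro!: tendsto_mult_left LIMSEQ_power_zero)
  \<comment> \<open>The gap between \<open>a\<close> and \<open>b\<close> absorbs the factor 2 and
    the two missing powers, so that \<open>2 * a ^ m \<le> b ^ (m + 2)\<close>.\<close>
  then have "eventually (\<lambda>m. 2 * (a / b) ^ m < b\<^sup>2) sequentially"
    by (metis mult_zero_right order_tendstoD(2))
  moreover have "(\<lambda>m. 2 * (1 - 2 * \<delta>) ^ m) \<longlonglongrightarrow> 2 * 0"
    using \<delta> by (intro tendsto_mult_left LIMSEQ_power_zero) auto
  then have "eventually (\<lambda>m. 2 * (1 - 2 * \<delta>) ^ m < 1) sequentially"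
    by (rule order_tendstoD(2)) simp
  ultimately have "eventually (\<lambda>m. 2 * (a / b) ^ m < b\<^sup>2 \<and> 2 * (1 - 2 * \<delta>) ^ m < 1) sequentially"
    by (rule eventually_conj)
  then obtain m0 where m0: "\<And>m. m \<ge> m0 \<Longrightarrow> 2 * (a / b) ^ m < b\<^sup>2 \<and> 2 * (1 - 2 * \<delta>) ^ m < 1"
    by (auto simp: eventually_sequentially)
  have "cycle_density l \<le> 1 + b ^ l" if "l \<ge> m0 + 2" for l
  proof (rule cycle_density_le)
    show "0 < l" using that by simp
    fix n :: nat
    define m where "m = l - 2"
    have l: "l = m + 2" and "m \<ge> m0" using that by (auto simp: m_def)
    have "0 < b" using \<open>0 < a\<close> \<open>a < b\<close> by simp
    have "2 * a ^ m = 2 * (a / b) ^ m * b ^ m" using \<open>0 < b\<close> by (simp add: power_divide)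
    also have "\<dots> \<le> b\<^sup>2 * b ^ m"
      using m0[OF \<open>m \<ge> m0\<close>] \<open>0 < b\<close> by (intro mult_right_mono) auto
    finally have A: "1 + 2 * a ^ m \<le> 1 + b ^ l" by (simp only: l power_add mult.commute add_le_cancel_left)
    have C: "2 * (1 - 2 * \<delta>) ^ m \<le> 1 + b ^ l"
      using m0[OF \<open>m \<ge> m0\<close>] zero_less_power[OF \<open>0 < b\<close>, of l] by linarith
    have "0 \<le> (real n / 2) ^ l" by simp
    from max_cycles_le[OF \<delta>(1,2), of m n, folded a_def l]
      mult_right_mono[OF A this] mult_right_mono[OF C this]
    show "real l * real (max_cycles n l) \<le> (1 + b ^ l) * (real n / 2) ^ l" by linarith
  qed
  then show "\<exists>l0. \<forall>l\<ge>l0. 4 dvd l \<longrightarrow> cycle_density l \<le> 1 + (2 / pi + \<epsilon>) ^ l"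
    unfolding b_def by blast
qed

end
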